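(* Consider the system $x_{t+1}=f(x_t)+Bu_t$ with $f(x)=\widehat AZ(x)+\varepsilon^f(x)$, the noisy data matrices $U_0,Z_0,Y_1$ with noise bound $\bar w$, a known matrix $\Delta\succeq0$ in $\mathbb R^{n\times n}$ with $D_0D_0^\top\preceq\Delta$, and functions $L$, $\alpha_1,\dots,\alpha_N$, matrices $\mathcal L_1,\dots,\mathcal L_N$ and a set $\mathcal X\subseteq\mathbb R^n$ satisfying properties (i)–(iii), all as described in the context. Assume moreover that $$\lim_{\|x\|\to0}\frac{\|\varepsilon^f(x)\|}{\|x\|}=0.$$ Let $\mathcal I=\{1,\dots,N\}$ and fix a scalar $\delta\in\mathbb R$. Suppose there exist $\lambda_i>0$, $R_i\in\mathbb R^{T\times S}$, $Q_i=Q_i^\top\succ0$ in $\mathbb R^{n\times n}$ for $i\in\mathcal I$, $M\in\mathbb R^{n\times n}$, $C_1\in\mathbb R^{(S-n)\times n}$ and an invertible $C_2\in\mathbb R^{(S-n)\times(S-n)}$ such that $$\begin{bmatrix}\mathrm{sym}\left(\begin{bmatrix}Y_1\\ \mathcal L_iZ_0\end{bmatrix}R_i\begin{bmatrix}\delta I_n&0\\0&I_{S-n}\end{bmatrix}\right)+\begin{bmatrix}Q_j-\lambda_i\Delta&0\\0&0\end{bmatrix}&\star&\star\\ \left(\begin{bmatrix}Y_1\\ \mathcal L_iZ_0\end{bmatrix}R_i\begin{bmatrix}I_n\\0\end{bmatrix}+\begin{bmatrix}\delta M^\top\\0\end{bmatrix}\right)^\top&\mathrm{sym}(M)-Q_i&\star\\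 R_i\begin{bmatrix}\delta I_n&0\\0&I_{S-n}\end{bmatrix}&R_i\begin{bmatrix}I_n\\0\end{bmatrix}&\lambda_iI_T\end{bmatrix}\succ0\quad\text{for all }(i,j)\in\mathcal I\times\mathcal I,$$ $$Z_0R_i=\begin{bmatrix}M&0\\C_1&C_2\end{bmatrix}\quad\text{for all }i\in\mathcal I.$$ Then the origin of the closed-loop system $$x_{t+1}=(\widehat A+BK(x_t))Z(x_t)+\varepsilon^f(x_t),\qquad K(x)=\sum_{i=1}^N\alpha_i(x)K_i,\qquad K_i=U_0R_i\begin{bmatrix}M&0\\C_1&C_2\end{bmatrix}^{-1},$$ is locally asymptotically stable. A Lyapunov function for the closed-loop system is given by $V(x_t)=x_t^\top P(x_t)x_t$ with $P(x_t)=\sum_{i=1}^N\alpha_i(x_t)Q_i^{-1}$.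
   Context: System and basis functions: $x_t\in\mathbb R^n$, $u_t\in\mathbb R^m$, $B\in\mathbb R^{n\times m}$ unknown, $f:\mathbb R^n\to\mathbb R^n$ continuous. $f(x)=\widehat AZ(x)+\varepsilon^f(x)$ where $\widehat A\in\mathbb R^{n\times S}$ is an unknown matrix, $Z:\mathbb R^n\to\mathbb R^S$ is known, continuous, $Z(0)=0$, of the form $Z(x)=\begin{bmatrix}x^\top&\underline Z(x)^\top\end{bmatrix}^\top$ with $\underline Z:\mathbb R^n\to\mathbb R^{S-n}$, and the approximation error $\varepsilon^f$ satisfies $\|\varepsilon^f(x)\|\le\bar\varepsilon$ for all $x\in\mathcal S$ for some known $\bar\varepsilon>0$, where $\mathcal S\subset\mathbb R^n$ with $0\in\mathrm{int}(\mathcal S)$. (In the paper $\widehat A$ is chosen as a minimizer over $A$ of $\int_{\mathcal S}\|f(x)-AZ(x)\|^2dx$.) Noisy data: from an open-loop trajectory $x^d_{k+1}=f(x^d_k)+Bu^d_k$ one records $\{u^d_k,y^d_k\}_{k=0}^T$ with $y^d_k=x^d_k+w^d_k$, where there is a known $\bar w$ with $\|w^d_k\|\le\bar w$ for all $k$. Known matrices: $U_0=[u^d_0\ \cdots\ u^d_{T-1}]\in\mathbb R^{m\times T}$, $Z_0=[Z(y^d_0)\ \cdots\ Z(y^d_{T-1})]\in\mathbb R^{S\times T}$, $Y_1=[y^d_1\ \cdots\ y^d_T]\in\mathbb R^{n\times T}$. Unknown matrices: $\widetilde Z_0=[Z(x^d_0)\ \cdots\ Z(x^d_{T-1})]$,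 $\mathcal E_0=[\varepsilon^f(x^d_0)\ \cdots\ \varepsilon^f(x^d_{T-1})]$, $W_1=[w^d_1\ \cdots\ w^d_T]$. With $D_0=W_1+\mathcal E_0+\widehat A(\widetilde Z_0-Z_0)$ one has $Y_1=\widehat AZ_0+BU_0+D_0$. It is assumed that a matrix $\Delta\succeq0$ with $D_0D_0^\top\preceq\Delta$ is known. Assumption on $L$: there is a function $L:\mathbb R^n\to\mathbb R^{(S-n)\times S}$ such that for all $x\in\mathcal X\subseteq\mathbb R^n$, where $0\in\mathrm{int}(\mathcal X)$: (i) $L(x)Z(x)=0$; (ii) $L(x)=\begin{bmatrix}L_1(x)&L_2(x)\end{bmatrix}$ with $L_2(x)\in\mathbb R^{(S-n)\times(S-n)}$ invertible; (iii) $L(x)=\sum_{i=1}^N\alpha_i(x)\mathcal L_i$ with $\mathcal L_i=L(v_i)$ for some $v_i\in\mathcal X$, where the $\alpha_i$ are continuous functions of $x\in\mathbb R^n$ satisfying $\alpha_i(x)\ge0$ and $\sum_{i=1}^N\alpha_i(x)=1$ (for $x\in\mathcal X$). Notation: $\mathrm{sym}(M)=M+M^\top$ for square $M$; $\star$ denotes blocks determined by symmetry; $\succ0$, $\succeq0$ mean symmetric positive (semi-)definite; $\|\cdot\|$ is the Euclidean norm. *)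

theory Defs
  imports "HOL-Analysis.Analysis"
begin

text \<open>
  Block structure is carried by sum types: a vector in \<open>real ^ ('n + 'r)\<close> has a first block
  indexed by \<open>'n\<close> and a second block indexed by \<open>'r\<close>. Recall that \<open>real ^ 'c ^ 'd\<close> is the type
  of matrices with rows indexed by \<open>'d\<close> and columns indexed by \<open>'c\<close>.
\<close>

definition vec_append :: "'a ^ 'n \<Rightarrow> 'a ^ 'r \<Rightarrow> 'a ^ ('n + 'r)" where
  "vec_append x y = (\<chi> i. case i of Inl a \<Rightarrow> x $ a | Inr b \<Rightarrow> y $ b)"

definition vcat :: "'a ^ 'c ^ 'n \<Rightarrow> 'a ^ 'c ^ 'r \<Rightarrow> 'a ^ 'c ^ ('n + 'r)" where
  "vcat A B = (\<chi> i. case i of Inl a \<Rightarrow> A $ a | Inr b \<Rightarrow> B $ b)"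

definition hcat :: "'a ^ 'c ^ 'n \<Rightarrow> 'a ^ 'd ^ 'n \<Rightarrow> 'a ^ ('c + 'd) ^ 'n" where
  "hcat A B = (\<chi> i. vec_append (A $ i) (B $ i))"

definition block_mat ::
  "'a ^ 'c ^ 'n \<Rightarrow> 'a ^ 'd ^ 'n \<Rightarrow> 'a ^ 'c ^ 'r \<Rightarrow> 'a ^ 'd ^ 'r \<Rightarrow> 'a ^ ('c + 'd) ^ ('n + 'r)" where
  "block_mat A B C D = vcat (hcat A B) (hcat C D)"

text \<open>
  The symmetric block matrix given by its lower triangle; the upper right block, usually
  displayed as a star, is the transpose of the lower left one.
\<close>

definition star_block ::
  "'a ^ 'n ^ 'n \<Rightarrow> 'a ^ 'n ^ 'r \<Rightarrow> 'a ^ 'r ^ 'r \<Rightarrow> 'a ^ ('n + 'r) ^ ('n + 'r)" where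
  "star_block A11 A21 A22 = block_mat A11 (transpose A21) A21 A22"

definition star_block3 ::
  "'a ^ 'n ^ 'n \<Rightarrow> 'a ^ 'n ^ 'r \<Rightarrow> 'a ^ 'r ^ 'r \<Rightarrow> 'a ^ 'n ^ 't \<Rightarrow> 'a ^ 'r ^ 't \<Rightarrow> 'a ^ 't ^ 't
    \<Rightarrow> 'a ^ (('n + 'r) + 't) ^ (('n + 'r) + 't)" where
  "star_block3 A11 A21 A22 A31 A32 A33 =
     star_block (star_block A11 A21 A22) (hcat A31 A32) A33"

definition symm :: "real ^ 'n ^ 'n \<Rightarrow> real ^ 'n ^ 'n" where
  "symm M = M + transpose M"

definition pos_def :: "real ^ 'n ^ 'n \<Rightarrow> bool" where
  "pos_def M \<longleftrightarrow> transpose M = M \<and> (\<forall>x. x \<noteq> 0 \<longrightarrow> 0 < x \<bullet> (M *v x))"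

definition pos_semidef :: "real ^ 'n ^ 'n \<Rightarrow> bool" where
  "pos_semidef M \<longleftrightarrow> transpose M = M \<and> (\<forall>x. 0 \<le> x \<bullet> (M *v x))"

text \<open>
  The matrix whose columns are \<open>v 0, \<dots>, v (T - 1)\<close>. The finite type \<open>'t\<close> indexing the columns
  carries no order, so an enumeration \<open>\<tau>\<close>, a bijection from \<open>'t\<close> onto \<open>{0..<T}\<close>, says which
  column belongs to which sample.
\<close>

definition columns :: "('t \<Rightarrow> nat) \<Rightarrow> (nat \<Rightarrow> 'a ^ 'n) \<Rightarrow> 'a ^ 't ^ 'n" where
  "columns \<tau> v = (\<chi> i k. v (\<tau> k) $ i)"

text \<open>
  Below, \<open>F\<close> is the right-hand side of the autonomous system \<open>x (t + 1) = F (x t)\<close>, so that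
  \<open>(F ^^ t) x\<close> is the state at time \<open>t\<close> when starting from \<open>x\<close>.
\<close>

definition locally_asymptotically_stable :: "('a::real_normed_vector \<Rightarrow> 'a) \<Rightarrow> bool" where
  "locally_asymptotically_stable F \<longleftrightarrow>
     F 0 = 0 \<and>
     (\<forall>e>0. \<exists>d>0. \<forall>x. norm x < d \<longrightarrow> (\<forall>t. norm ((F ^^ t) x) < e)) \<and>
     (\<exists>d>0. \<forall>x. norm x < d \<longrightarrow> (\<lambda>t. (F ^^ t) x) \<longlonglongrightarrow> 0)"

definition lyapunov_function ::
  "('a::real_normed_vector \<Rightarrow> 'a) \<Rightarrow> ('a \<Rightarrow> real) \<Rightarrow> bool" where
  "lyapunov_function F V \<longleftrightarrow>
     (\<exists>U. open U \<and> 0 \<in> U \<and> continuous_on U V \<and> V 0 = 0 \<and>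
          (\<forall>x\<in>U - {0}. 0 < V x \<and> V (F x) - V x < 0))"

end

theory Submission
  imports Defs
begin

text \<open>
  Put \<open>G = [M 0; C\<^sub>1 C\<^sub>2]\<close> and \<open>w = G\<^sup>-\<^sup>1 Z(x)\<close>. Since \<open>Z\<^sub>0 R\<^sub>i = G\<close>, the closed-loop matrix of
  vertex \<open>i\<close> satisfies \<open>(A + B K\<^sub>i) Z(x) = (Y\<^sub>1 - D\<^sub>0) R\<^sub>i w\<close>, and \<open>M w\<^sub>1 = x\<close> because the first block
  of \<open>Z(x)\<close> is \<open>x\<close>. The matrix inequality is tested with first component \<open>(y, w\<^sub>2)\<close>, second
  component \<open>c = w\<^sub>1 - \<delta> y\<close> and third component \<open>- D\<^sub>0\<^sup>T y\<close>, for an arbitrary \<open>y\<close>. Averaging over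
  \<open>i\<close> with the weights \<open>\<alpha>\<^sub>i(x)\<close> removes the terms in \<open>w\<^sub>2\<close>, as \<open>L(x) Z(x) = 0\<close>, and leaves, for the
  nominal successor \<open>g\<close> of \<open>x\<close>,
  \<open>0 < 2 y\<^sup>T g + y\<^sup>T Q\<^sub>j y + \<Sum>\<^sub>i \<alpha>\<^sub>i(x) (2 c\<^sup>T x - c\<^sup>T Q\<^sub>i c)\<close>. The last sum is at most \<open>V(x)\<close>, and
  \<open>y = - Q\<^sub>j\<^sup>-\<^sup>1 g\<close> gives \<open>g\<^sup>T Q\<^sub>j\<^sup>-\<^sup>1 g < V(x)\<close> for every \<open>j\<close>. Quantitatively, the gap is at least
  a constant times \<open>\<parallel>x\<parallel>\<^sup>2\<close>, so it survives the perturbation \<open>\<epsilon>\<^sup>f(x) = o(\<parallel>x\<parallel>)\<close> near the origin.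
\<close>

subsection \<open>Block vectors and matrices\<close>

lemma vec_append_cases:
  fixes w :: "'a ^ ('n::finite + 'r::finite)"
  obtains x y where "w = vec_append x y"
proof
  show "w = vec_append (\<chi> i. w $ Inl i) (\<chi> i. w $ Inr i)"
    by (simp add: vec_append_def vec_eq_iff split: sum.split)
qed

lemma sum_UNIV_Plus:
  fixes g :: "'n::finite + 'r::finite \<Rightarrow> 'b::comm_monoid_add"
  shows "sum g UNIV = (\<Sum>i\<in>UNIV. g (Inl i)) + (\<Sum>i\<in>UNIV. g (Inr i))"
proof -
  have "sum g (UNIV <+> UNIV) = (\<Sum>i\<in>UNIV. g (Inl i)) + (\<Sum>i\<in>UNIV. g (Inr i))"
    by (subst sum.Plus) (simp_all add: o_def)
  then show ?thesis by simp
qed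

lemma inner_vec_append [simp]:
  fixes x x' :: "real ^ 'n" and y y' :: "real ^ 'r"
  shows "vec_append x y \<bullet> vec_append x' y' = x \<bullet> x' + y \<bullet> y'"
  by (simp add: inner_vec_def sum_UNIV_Plus vec_append_def)

lemma vec_append_add [simp]:
  "vec_append x y + vec_append x' y' = vec_append (x + x') (y + y')"
  by (simp add: vec_append_def vec_eq_iff split: sum.split)

lemma vec_append_0 [simp]: "vec_append 0 0 = 0"
  by (simp add: vec_append_def vec_eq_iff split: sum.split)

lemma vec_append_eq_iff [simp]:
  "vec_append x y = vec_append x' y' \<longleftrightarrow> x = x' \<and> y = y'"
  by (auto simp: vec_append_def vec_eq_iff split: sum.split_asm sum.split)

lemma vec_append_eq_0_iff [simp]: "vec_append x y = 0 \<longleftrightarrow> x = 0 \<and> y = 0"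
  by (metis vec_append_0 vec_append_eq_iff)

lemma vcat_mult [simp]: "vcat A B *v x = vec_append (A *v x) (B *v x)"
  by (auto simp: vcat_def vec_append_def matrix_vector_mult_def vec_eq_iff split: sum.split)

lemma hcat_mult [simp]:
  fixes A :: "real ^ 'c ^ 'n" and B :: "real ^ 'd ^ 'n"
  shows "hcat A B *v vec_append x y = A *v x + B *v y"
  by (simp add: hcat_def vec_append_def matrix_vector_mult_def vec_eq_iff sum_UNIV_Plus)

lemma block_mat_mult [simp]:
  fixes A :: "real ^ 'c ^ 'n" and B :: "real ^ 'd ^ 'n"
  shows "block_mat A B C D *v vec_append x y = vec_append (A *v x + B *v y) (C *v x + D *v y)"
  by (simp add: block_mat_def)

lemma star_block_mult [simp]:
  fixes A :: "real ^ 'n ^ 'n"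
  shows "star_block A B C *v vec_append x y
    = vec_append (A *v x + transpose B *v y) (B *v x + C *v y)"
  by (simp add: star_block_def)

lemma inner_transpose_mult:
  fixes A :: "real ^ 'n ^ 'm"
  shows "x \<bullet> (transpose A *v y) = y \<bullet> (A *v x)"
  by (metis dot_lmul_matrix inner_commute transpose_matrix_vector)

lemma inner_symm_mult: "x \<bullet> (symm A *v x) = 2 * (x \<bullet> (A *v x))"
  by (simp add: symm_def matrix_vector_mult_add_rdistrib inner_add_right
      inner_transpose_mult del: transpose_matrix_vector)

lemma quadratic_form_star_block:
  fixes A :: "real ^ 'n ^ 'n"
  shows "vec_append x y \<bullet> (star_block A B C *v vec_append x y)
    = x \<bullet> (A *v x) + 2 * (y \<bullet> (B *v x)) + y \<bullet> (C *v y)"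
  by (simp add: inner_add_right inner_transpose_mult del: transpose_matrix_vector)

lemma quadratic_form_star_block3:
  fixes A :: "real ^ 'n ^ 'n"
  shows "vec_append (vec_append x y) z \<bullet>
      (star_block3 A B C D E F *v vec_append (vec_append x y) z)
    = x \<bullet> (A *v x) + 2 * (y \<bullet> (B *v x)) + y \<bullet> (C *v y)
      + 2 * (z \<bullet> (D *v x + E *v y)) + z \<bullet> (F *v z)"
  unfolding star_block3_def quadratic_form_star_block by simp

lemma matrix_vector_mult_sum_left:
  fixes A :: "'i \<Rightarrow> real ^ 'n ^ 'm"
  shows "(\<Sum>i\<in>I. A i) *v x = (\<Sum>i\<in>I. A i *v x)"
  by (induction I rule: infinite_finite_induct) (simp_all add: matrix_vector_mult_add_rdistrib)

lemma matrix_mult_columns: "A ** columns \<tau> v = columns \<tau> (\<lambda>k. A *v v k)"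
  by (simp add: columns_def matrix_matrix_mult_def matrix_vector_mult_def vec_eq_iff)

lemma columns_add: "columns \<tau> v + columns \<tau> v' = columns \<tau> (\<lambda>k. v k + v' k)"
  by (simp add: columns_def vec_eq_iff)

text \<open>Only the sampled indices \<open>\<tau> j\<close> enter, so equations valid just for
  times below \<open>T\<close> can be used column by column.\<close>

lemma columns_cong: "(\<And>j. v (\<tau> j) = v' (\<tau> j)) \<Longrightarrow> columns \<tau> v = columns \<tau> v'"
  by (simp add: columns_def)

subsection \<open>Inverses and definite matrices\<close>

text \<open>The inverse is defined by choice, so its properties come from the existence of some
  two-sided inverse.\<close>

lemma matrix_inv_mult:
  fixes A :: "real ^ 'n ^ 'n"
  assumes "invertible A"
  shows "A ** matrix_inv A = mat 1" "matrix_inv A ** A = mat 1"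
  using someI_ex[of "\<lambda>B. A ** B = mat 1 \<and> B ** A = mat 1"] assms
  by (auto simp: invertible_def matrix_inv_def)

lemma mult_matrix_inv_vector:
  fixes A :: "real ^ 'n ^ 'n"
  assumes "invertible A"
  shows "A *v (matrix_inv A *v x) = x"
  by (simp add: matrix_vector_mul_assoc matrix_inv_mult[OF assms])

lemma invertible_if_ker_trivial:
  fixes A :: "real ^ 'n ^ 'n"
  assumes "\<And>x. A *v x = 0 \<Longrightarrow> x = 0"
  shows "invertible A"
  using assms by (simp add: invertible_left_inverse matrix_left_invertible_ker)

lemma invertible_block_triangular:
  fixes A :: "real ^ 'n ^ 'n" and D :: "real ^ 'r ^ 'r"
  assumes "invertible A" "invertible D"
  shows "invertible (block_mat A 0 C D)"
proof (rule invertible_if_ker_trivial)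
  fix w assume w: "block_mat A 0 C D *v w = 0"
  obtain x y where xy: "w = vec_append x y" by (rule vec_append_cases)
  with w have "A *v x = 0" "C *v x + D *v y = 0" by simp_all
  moreover from this(1) have "x = 0"
    using assms(1) by (simp add: invertible_left_inverse matrix_left_invertible_ker)
  ultimately show "w = 0"
    using assms(2) xy by (simp add: invertible_left_inverse matrix_left_invertible_ker)
qed

lemma pos_def_inner_pos: "pos_def A \<Longrightarrow> x \<noteq> 0 \<Longrightarrow> 0 < x \<bullet> (A *v x)"
  by (simp add: pos_def_def)

lemma pos_def_inner_nonneg: "pos_def A \<Longrightarrow> 0 \<le> x \<bullet> (A *v x)"
  by (cases "x = 0") (auto dest: pos_def_inner_pos[of A x])

lemma pos_def_invertible:
  assumes "pos_def A"
  shows "invertible A"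
proof (rule invertible_if_ker_trivial, rule ccontr)
  fix x assume "A *v x = 0" "x \<noteq> 0"
  then show False using pos_def_inner_pos[OF assms] by (metis inner_zero_right less_irrefl)
qed

lemma pos_def_inner_commute:
  assumes "pos_def A"
  shows "x \<bullet> (A *v y) = y \<bullet> (A *v x)"
  using assms inner_transpose_mult[of x A y] by (simp add: pos_def_def)

text \<open>Substituting \<open>x = A *v u\<close> turns the form of the inverse at \<open>x\<close>
  into the form of \<open>A\<close> at \<open>u\<close>, and symmetry carries over in the same
  way.\<close>

lemma pos_def_matrix_inv:
  assumes "pos_def A"
  shows "pos_def (matrix_inv A)"
  unfolding pos_def_def
proof (intro conjI allI impI)
  note inv = pos_def_invertible[OF assms]
  have "x \<bullet> (transpose (matrix_inv A) *v y) = x \<bullet> (matrix_inv A *v y)" for x y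
    using pos_def_inner_commute[OF assms, of "matrix_inv A *v x" "matrix_inv A *v y"]
    by (simp add: inner_transpose_mult mult_matrix_inv_vector[OF inv] inner_commute
        del: transpose_matrix_vector)
  then show "transpose (matrix_inv A) = matrix_inv A"
    by (metis matrix_eq vector_eq_rdot inner_commute)
  fix x :: "real ^ 'a" assume "x \<noteq> 0"
  then have "matrix_inv A *v x \<noteq> 0"
    by (metis mult_matrix_inv_vector[OF inv] matrix_vector_mult_0_right)
  from pos_def_inner_pos[OF assms this]
  show "0 < x \<bullet> (matrix_inv A *v x)"
    by (simp add: mult_matrix_inv_vector[OF inv] inner_commute)
qed

text \<open>Completing the square: the right-hand side is the maximum of the left one over \<open>c\<close>.\<close>

lemma pos_def_conjugate_le:
  assumes "pos_def A"
  shows "2 * (c \<bullet> x) - c \<bullet> (A *v c) \<le> x \<bullet> (matrix_inv A *v x)"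
proof -
  let ?z = "matrix_inv A *v x"
  have "0 \<le> (c - ?z) \<bullet> (A *v (c - ?z))" by (rule pos_def_inner_nonneg[OF assms])
  then show ?thesis
    using mult_matrix_inv_vector[OF pos_def_invertible[OF assms], of x]
      pos_def_inner_commute[OF assms, of ?z c]
    by (simp add: matrix_vector_mult_diff_distrib inner_diff_left inner_diff_right inner_commute)
qed

text \<open>The form attains its minimum on the compact unit sphere, where it is positive;
  homogeneity of degree two carries this minimum to all vectors.\<close>

lemma pos_def_lower_bound:
  fixes A :: "real ^ 'n ^ 'n"
  assumes "\<And>x. x \<noteq> 0 \<Longrightarrow> 0 < x \<bullet> (A *v x)"
  obtains \<mu> where "0 < \<mu>" "\<And>x. \<mu> * (norm x)\<^sup>2 \<le> x \<bullet> (A *v x)"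
proof -
  have "continuous_on (sphere 0 1) (\<lambda>x. x \<bullet> (A *v x))"
    by (intro continuous_intros linear_continuous_on_compose matrix_vector_mul_linear)
  moreover have "sphere (0 :: real ^ 'n) 1 \<noteq> {}" by simp
  ultimately obtain u where u: "u \<in> sphere 0 1"
    "\<And>x. x \<in> sphere 0 1 \<Longrightarrow> u \<bullet> (A *v u) \<le> x \<bullet> (A *v x)"
    using continuous_attains_inf[OF compact_sphere] by blast
  have "(u \<bullet> (A *v u)) * (norm x)\<^sup>2 \<le> x \<bullet> (A *v x)" for x
  proof (cases "x = 0")
    case False
    define y where "y = x /\<^sub>R norm x"
    have x: "x = norm x *\<^sub>R y" using False by (simp add: y_def)
    have "y \<in> sphere 0 1" using False by (simp add: y_def)
    from u(2)[OF this] have "(u \<bullet> (A *v u)) * (norm x)\<^sup>2 \<le> (y \<bullet> (A *v y)) * (norm x)\<^sup>2"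
      by (rule mult_right_mono) simp
    also have "\<dots> = x \<bullet> (A *v x)"
      using arg_cong[OF x, of "\<lambda>x. x \<bullet> (A *v x)"]
      by (simp add: matrix_vector_mult_scaleR power2_eq_square)
    finally show ?thesis .
  qed simp
  moreover have "0 < u \<bullet> (A *v u)" using u(1) by (intro assms) auto
  ultimately show thesis using that by blast
qed

text \<open>Finitely many conditions, each stable under shrinking its constant, share the minimum of
  the constants. The bounds \<open>\<mu>\<close>, \<open>m\<close> and \<open>\<eta>\<close> of the
  main proof are made independent of the vertex in this way.\<close>

lemma pos_bound_uniform:
  fixes \<Phi> :: "'i \<Rightarrow> real \<Rightarrow> bool"
  assumes "finite I" "\<And>i. i \<in> I \<Longrightarrow> \<exists>\<mu>>0. \<Phi> i \<mu>"
    and mono: "\<And>i \<mu> \<nu>. i \<in> I \<Longrightarrow> \<Phi> i \<mu> \<Longrightarrow> 0 < \<nu> \<Longrightarrow> \<nu> \<le> \<mu> \<Longrightarrow> \<Phi> i \<nu>"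
  obtains \<mu> where "0 < \<mu>" "\<And>i. i \<in> I \<Longrightarrow> \<Phi> i \<mu>"
proof -
  obtain m where m: "\<And>i. i \<in> I \<Longrightarrow> 0 < m i \<and> \<Phi> i (m i)"
    using assms(2) by metis
  \<comment> \<open>Inserting 1 keeps the set nonempty if \<open>I\<close> is empty.\<close>
  define \<mu> where "\<mu> = Min (insert 1 (m ` I))"
  have "0 < \<mu>" using m assms(1) by (auto simp: \<mu>_def)
  moreover have "\<Phi> i \<mu>" if "i \<in> I" for i
    using mono[OF that _ \<open>0 < \<mu>\<close>] m[OF that] assms(1) that by (auto simp: \<mu>_def)
  ultimately show thesis using that by blast
qed

lemma bilinear_bound:
  fixes A :: "real ^ 'n ^ 'm"
  obtains k where "0 < k" "\<And>x y. \<bar>x \<bullet> (A *v y)\<bar> \<le> k * norm x * norm y"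
proof -
  obtain k where k: "0 < k" "\<And>y. norm (A *v y) \<le> norm y * k"
    using bounded_linear.pos_bounded[OF matrix_vector_mul_bounded_linear] by blast
  have "\<bar>x \<bullet> (A *v y)\<bar> \<le> k * norm x * norm y" for x y
    using order_trans[OF Cauchy_Schwarz_ineq2 mult_left_mono[OF k(2) norm_ge_zero]]
    by (simp add: mult_ac)
  with k(1) show thesis using that by blast
qed

text \<open>The premises confine \<open>norm g\<close> to a multiple of \<open>s\<close>, so in the
  expansion at \<open>g + e\<close> the cross term and the term in \<open>e\<close> are of order
  \<open>\<eta> * s\<^sup>2\<close>, and half of the decrease survives. Later \<open>s\<close> is
  \<open>norm x\<close> and \<open>b\<close> is \<open>V x\<close>, on which \<open>\<eta>\<close>
  must not depend.\<close>

lemma decrease_robust_small_perturbation: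
  fixes A :: "real ^ 'n ^ 'n"
  assumes A: "pos_def A" and "0 < C" "0 < \<kappa>"
  shows "\<exists>\<eta>>0. \<forall>s g e b. g \<bullet> (A *v g) \<le> b - \<kappa> * s\<^sup>2 \<longrightarrow> b \<le> C * s\<^sup>2 \<longrightarrow> 0 \<le> s \<longrightarrow>
    norm e \<le> \<eta> * s \<longrightarrow> (g + e) \<bullet> (A *v (g + e)) \<le> b - \<kappa> / 2 * s\<^sup>2"
proof -
  obtain m where m: "0 < m" "\<And>x. m * (norm x)\<^sup>2 \<le> x \<bullet> (A *v x)"
    using pos_def_lower_bound[of A] pos_def_inner_pos[OF A] by blast
  obtain k where k: "0 < k" "\<And>x y. \<bar>x \<bullet> (A *v y)\<bar> \<le> k * norm x * norm y"
    using bilinear_bound[of A] by blast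
  \<comment> \<open>The premises give \<open>m * (norm g)\<^sup>2 \<le> C * s\<^sup>2\<close>;
    \<open>q\<close> is the resulting factor in \<open>norm g \<le> q * s\<close>.\<close>
  define q where "q = sqrt (C / m)"
  have q: "0 \<le> q" "m * q\<^sup>2 = C" using \<open>0 < C\<close> m(1) by (simp_all add: q_def)
  \<comment> \<open>The two error terms add up to at most
    \<open>k * (2 * q + 1) * \<eta> * s\<^sup>2\<close>, which should not exceed half of
    \<open>\<kappa> * s\<^sup>2\<close>. The cap 1 gives \<open>norm e \<le> s\<close>, so that the
    term quadratic in \<open>e\<close> is bounded linearly in \<open>\<eta>\<close>.\<close>
  define \<eta> where "\<eta> = min 1 (\<kappa> / (2 * k * (2 * q + 1)))"
  have den: "0 < 2 * k * (2 * q + 1)" using k q by (intro mult_pos_pos) auto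
  have \<eta>: "0 < \<eta>" "\<eta> \<le> 1" using den \<open>0 < \<kappa>\<close> by (simp_all add: \<eta>_def)
  have "\<eta> \<le> \<kappa> / (2 * k * (2 * q + 1))" by (simp add: \<eta>_def)
  with den have \<eta>': "k * (2 * q + 1) * \<eta> \<le> \<kappa> / 2" by (simp add: pos_le_divide_eq field_simps)
  have "(g + e) \<bullet> (A *v (g + e)) \<le> b - \<kappa> / 2 * s\<^sup>2"
    if g: "g \<bullet> (A *v g) \<le> b - \<kappa> * s\<^sup>2" and b: "b \<le> C * s\<^sup>2" and "0 \<le> s"
      and e: "norm e \<le> \<eta> * s" for s b :: real and g e
  proof -
    have "m * (norm g)\<^sup>2 \<le> C * s\<^sup>2"
      using m(2)[of g] g b \<open>0 < \<kappa>\<close> zero_le_power2[of s] by (smt (verit) mult_nonneg_nonneg)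
    also have "\<dots> = m * (q * s)\<^sup>2" using q(2) by (simp add: power_mult_distrib flip: mult.assoc)
    finally have "norm g \<le> q * s"
      using m(1) q(1) \<open>0 \<le> s\<close> by (auto intro: power2_le_imp_le)
    then have "k * norm g * norm e \<le> k * (q * s) * (\<eta> * s)"
      using e k(1) \<eta>(1) q(1) \<open>0 \<le> s\<close> by (intro mult_mono) auto
    then have ge: "g \<bullet> (A *v e) \<le> k * q * \<eta> * s\<^sup>2"
      using k(2)[of g e] by (simp add: power2_eq_square mult_ac)
    have "norm e \<le> 1 * s" using e \<eta>(2) \<open>0 \<le> s\<close> by (meson mult_right_mono order_trans)
    then have "k * norm e * norm e \<le> k * s * (\<eta> * s)"
      using e k(1) \<open>0 \<le> s\<close> by (intro mult_mono) auto
    then have ee: "e \<bullet> (A *v e) \<le> k * \<eta> * s\<^sup>2"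
      using k(2)[of e e] by (simp add: power2_eq_square mult_ac)
    have "(g + e) \<bullet> (A *v (g + e)) = g \<bullet> (A *v g) + 2 * (g \<bullet> (A *v e)) + e \<bullet> (A *v e)"
      using pos_def_inner_commute[OF A, of e g]
      by (simp add: matrix_vector_right_distrib inner_add_left inner_add_right)
    also have "\<dots> \<le> b - \<kappa> * s\<^sup>2 + (k * (2 * q + 1) * \<eta>) * s\<^sup>2"
      using g ge ee by (simp add: algebra_simps)
    also have "\<dots> \<le> b - \<kappa> * s\<^sup>2 + \<kappa> / 2 * s\<^sup>2"
      using \<eta>' by (intro add_left_mono mult_right_mono) auto
    finally show ?thesis by simp
  qed
  with \<eta>(1) show ?thesis by blast
qed

subsection \<open>Lyapunov stability\<close>

text \<open>Sublevel sets of \<open>V\<close> trap the orbit, which gives stability; the decrease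
  telescopes, so the squared norms along an orbit are summable and tend to zero. The lower bound is
  required at \<open>F x\<close> separately because \<open>F x\<close> is not yet known to lie in
  the ball of radius \<open>r\<close>.\<close>

lemma locally_asymptotically_stable_if_quadratic_decrease:
  fixes F :: "'a::real_normed_vector \<Rightarrow> 'a" and V :: "'a \<Rightarrow> real"
  assumes "0 < r" "0 < m" "0 < \<kappa>" and F0: "F 0 = 0" and V0: "V 0 = 0" and cont: "isCont V 0"
    and lower: "\<And>x. norm x < r \<Longrightarrow> m * (norm x)\<^sup>2 \<le> V x"
    and lower': "\<And>x. norm x < r \<Longrightarrow> m * (norm (F x))\<^sup>2 \<le> V (F x)"
    and decr: "\<And>x. norm x < r \<Longrightarrow> V (F x) \<le> V x - \<kappa> * (norm x)\<^sup>2"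
  shows "locally_asymptotically_stable F"
proof -
  have stay: "\<exists>d>0. \<forall>x. norm x < d \<longrightarrow> (\<forall>t. norm ((F ^^ t) x) < e)"
    if "0 < e" "e \<le> r" for e
  proof -
    have "0 < m * e\<^sup>2" using assms that by simp
    then obtain d where d: "0 < d" "\<And>x. norm x < d \<Longrightarrow> \<bar>V x\<bar> < m * e\<^sup>2"
      using cont V0 unfolding continuous_at_eps_delta by (fastforce simp: dist_norm)
    \<comment> \<open>Both bounds go through the induction: the one on the norm keeps the orbit
      where the decrease holds, and the one on \<open>V\<close>, with the lower bound at the next
      state, restores the norm bound.\<close>
    have "norm ((F ^^ t) x) < e \<and> V ((F ^^ t) x) < m * e\<^sup>2" if x: "norm x < min d e" for x t
    proof (induction t)
      case 0
      then show ?case using x d(2)[of x] by auto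
    next
      case (Suc t)
      let ?y = "(F ^^ t) x"
      have y: "norm ?y < r" using Suc \<open>e \<le> r\<close> by auto
      have "V (F ?y) \<le> V ?y" using decr[OF y] \<open>0 < \<kappa>\<close>
        by (smt (verit) mult_nonneg_nonneg zero_le_power2)
      with Suc have V: "V (F ?y) < m * e\<^sup>2" by auto
      then have "m * (norm (F ?y))\<^sup>2 < m * e\<^sup>2" using lower'[OF y] by auto
      then have "norm (F ?y) < e" using \<open>0 < m\<close> \<open>0 < e\<close>
        by (simp add: power_less_imp_less_base)
      with V show ?case by simp
    qed
    then show ?thesis using d(1) that(1) by (intro exI[of _ "min d e"]) auto
  qed
  obtain d where d: "0 < d" "\<And>x t. norm x < d \<Longrightarrow> norm ((F ^^ t) x) < r"
    using stay[OF \<open>0 < r\<close>] by blast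
  have "(\<lambda>t. (F ^^ t) x) \<longlonglongrightarrow> 0" if x: "norm x < d" for x
  proof -
    let ?s = "\<lambda>t. (norm ((F ^^ t) x))\<^sup>2"
    have part: "\<kappa> * (\<Sum>t<k. ?s t) \<le> V x - V ((F ^^ k) x)" for k
    proof (induction k)
      case (Suc k)
      then show ?case using decr[OF d(2)[OF x, of k]] by (simp add: distrib_left)
    qed simp
    have "(\<Sum>t<k. ?s t) \<le> V x / \<kappa>" for k
    proof -
      have "0 \<le> V ((F ^^ k) x)" using lower[OF d(2)[OF x, of k]] \<open>0 < m\<close>
        by (smt (verit) mult_nonneg_nonneg zero_le_power2)
      with part[of k] show ?thesis using \<open>0 < \<kappa>\<close> by (simp add: field_simps)
    qed
    then have "summable ?s" by (intro summableI_nonneg_bounded) auto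
    then have "?s \<longlonglongrightarrow> 0" by (rule summable_LIMSEQ_zero)
    from tendsto_real_sqrt[OF this] show ?thesis
      by (simp add: tendsto_norm_zero_iff)
  qed
  moreover have "\<exists>d>0. \<forall>x. norm x < d \<longrightarrow> (\<forall>t. norm ((F ^^ t) x) < e)" if "0 < e" for e
  proof -
    have "0 < min e r" using that \<open>0 < r\<close> by simp
    from stay[OF this] obtain d' where "0 < d'"
      "\<And>x t. norm x < d' \<Longrightarrow> norm ((F ^^ t) x) < min e r" by auto
    then show ?thesis by (intro exI[of _ d']) auto
  qed
  ultimately show ?thesis
    unfolding locally_asymptotically_stable_def using F0 d(1) by blast
qed

subsection \<open>The matrix inequality as a dissipation inequality\<close>

text \<open>
  Testing the block matrix with third component \<open>- D\<^sup>T y\<close> replaces \<open>Y\<close> by \<open>Y - D\<close>, and the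
  remaining quadratic term in \<open>D\<close> is absorbed by \<open>\<Delta>\<close>.
\<close>

lemma dissipation_inequality_if_lmi:
  fixes Y D :: "real ^ 't ^ 'n" and W :: "real ^ 't ^ 'r" and R :: "real ^ ('n + 'r) ^ 't"
    and \<Delta> M Q Q' :: "real ^ 'n ^ 'n"
  assumes "0 < l" and bound: "pos_semidef (\<Delta> - D ** transpose D)"
    and lmi: "pos_def (star_block3
        (symm (vcat Y W ** R ** block_mat (\<delta> *\<^sub>R mat 1) 0 0 (mat 1))
           + block_mat (Q' - l *\<^sub>R \<Delta>) 0 0 0)
        (transpose (vcat Y W ** R ** vcat (mat 1) 0 + vcat (\<delta> *\<^sub>R transpose M) 0))
        (symm M - Q)
        (R ** block_mat (\<delta> *\<^sub>R mat 1) 0 0 (mat 1))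
        (R ** vcat (mat 1) 0)
        (l *\<^sub>R mat 1))" (is "pos_def ?S")
  shows "\<exists>\<mu>>0. \<forall>y z c. \<mu> * ((norm y)\<^sup>2 + (norm c)\<^sup>2) \<le>
    2 * (y \<bullet> ((Y - D) *v (R *v vec_append (\<delta> *\<^sub>R y + c) z)))
    + 2 * (z \<bullet> (W *v (R *v vec_append (\<delta> *\<^sub>R y + c) z)))
    + y \<bullet> (Q' *v y) + 2 * (c \<bullet> (M *v (\<delta> *\<^sub>R y + c))) - c \<bullet> (Q *v c)"
proof -
  obtain \<mu> where \<mu>: "0 < \<mu>" "\<And>x. \<mu> * (norm x)\<^sup>2 \<le> x \<bullet> (?S *v x)"
    using pos_def_lower_bound[of ?S] pos_def_inner_pos[OF lmi] by blast
  have "\<mu> * ((norm y)\<^sup>2 + (norm c)\<^sup>2) \<le>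
    2 * (y \<bullet> ((Y - D) *v (R *v vec_append (\<delta> *\<^sub>R y + c) z)))
    + 2 * (z \<bullet> (W *v (R *v vec_append (\<delta> *\<^sub>R y + c) z)))
    + y \<bullet> (Q' *v y) + 2 * (c \<bullet> (M *v (\<delta> *\<^sub>R y + c))) - c \<bullet> (Q *v c)" for y z c
  proof -
    define s where "s = - (transpose D *v y)"
    let ?x = "vec_append (vec_append (vec_append y z) c) s"
    let ?v = "R *v vec_append (\<delta> *\<^sub>R y) z" and ?v' = "R *v vec_append c 0"
    have v: "R *v vec_append (\<delta> *\<^sub>R y + c) z = ?v + ?v'"
      by (simp flip: matrix_vector_right_distrib)
    \<comment> \<open>The components \<open>z\<close> and \<open>s\<close> are dropped from the
      norm: \<open>y\<close> and \<open>c\<close> alone control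
      \<open>\<delta> *\<^sub>R y + c\<close>, which is what the later bound needs.\<close>
    have "\<mu> * ((norm y)\<^sup>2 + (norm c)\<^sup>2) \<le> \<mu> * (norm ?x)\<^sup>2"
      using \<mu>(1) by (simp add: power2_norm_eq_inner)
    also have "\<dots> \<le> ?x \<bullet> (?S *v ?x)" by (rule \<mu>(2))
    also have "\<dots> = 2 * (y \<bullet> (Y *v (?v + ?v')) + z \<bullet> (W *v (?v + ?v')))
        + y \<bullet> (Q' *v y) - l * (y \<bullet> (\<Delta> *v y)) + 2 * \<delta> * (c \<bullet> (M *v y))
        + 2 * (c \<bullet> (M *v c)) - c \<bullet> (Q *v c) + 2 * (s \<bullet> (?v + ?v')) + l * (s \<bullet> s)"
      unfolding quadratic_form_star_block3
      by (simp add: matrix_vector_mult_add_rdistrib matrix_vector_mult_diff_rdistrib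
          inner_symm_mult inner_transpose_mult inner_add_right inner_diff_right
          matrix_vector_right_distrib scaleR_matrix_vector_assoc[symmetric]
          matrix_vector_mul_assoc[symmetric] algebra_simps del: transpose_matrix_vector)
    also have "s \<bullet> (?v + ?v') = - (y \<bullet> (D *v (?v + ?v')))"
      by (metis s_def inner_minus_left inner_commute inner_transpose_mult)
    also have "l * (s \<bullet> s) \<le> l * (y \<bullet> (\<Delta> *v y))"
    proof -
      have "0 \<le> y \<bullet> ((\<Delta> - D ** transpose D) *v y)"
        using bound by (simp add: pos_semidef_def)
      also have "\<dots> = y \<bullet> (\<Delta> *v y) - (transpose D *v y) \<bullet> (transpose D *v y)"
        by (metis matrix_vector_mult_diff_rdistrib inner_diff_right matrix_vector_mul_assoc
            inner_transpose_mult)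
      finally show ?thesis using \<open>0 < l\<close> by (simp add: s_def)
    qed
    finally show ?thesis unfolding v
      by (simp add: matrix_vector_mult_diff_rdistrib inner_diff_right
          matrix_vector_right_distrib inner_add_right matrix_vector_mult_scaleR algebra_simps)
  qed
  with \<mu>(1) show ?thesis by blast
qed

lemma convex_sum_ge:
  fixes a g :: "'i \<Rightarrow> real"
  assumes "\<And>i. i \<in> I \<Longrightarrow> 0 \<le> a i" "sum a I = 1" "\<And>i. i \<in> I \<Longrightarrow> b \<le> g i"
  shows "b \<le> (\<Sum>i\<in>I. a i * g i)"
proof -
  have "b = (\<Sum>i\<in>I. a i * b)" using assms(2) by (simp flip: sum_distrib_right)
  also have "\<dots> \<le> (\<Sum>i\<in>I. a i * g i)" using assms by (intro sum_mono mult_left_mono) auto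
  finally show ?thesis .
qed

lemma convex_sum_le:
  fixes a g :: "'i \<Rightarrow> real"
  assumes "\<And>i. i \<in> I \<Longrightarrow> 0 \<le> a i" "sum a I = 1" "\<And>i. i \<in> I \<Longrightarrow> g i \<le> b"
  shows "(\<Sum>i\<in>I. a i * g i) \<le> b"
  using convex_sum_ge[of I a "- b" "\<lambda>i. - g i"] assms by (simp add: sum_negf)

text \<open>
  The component \<open>z\<close> is dictated by the state, whereas \<open>y\<close> is free; it is chosen as
  \<open>- Q'\<^sup>-\<^sup>1 g\<close>, which minimizes \<open>2 y\<^sup>T g + y\<^sup>T Q' y\<close>.
\<close>

lemma averaged_dissipation_decrease:
  fixes Q :: "'i \<Rightarrow> real ^ 'n ^ 'n" and Q' :: "real ^ 'n ^ 'n"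
    and G :: "'i \<Rightarrow> real ^ 'n" and H :: "'i \<Rightarrow> real ^ 'r"
  assumes a: "\<And>i. i \<in> I \<Longrightarrow> 0 \<le> a i" "sum a I = 1"
    and Q: "\<And>i. i \<in> I \<Longrightarrow> pos_def (Q i)" and Q': "pos_def Q'" and "0 \<le> \<mu>"
    and H: "(\<Sum>i\<in>I. a i *\<^sub>R H i) = 0"
    and diss: "\<And>i y c. i \<in> I \<Longrightarrow> \<delta> *\<^sub>R y + c = p \<Longrightarrow> \<mu> * ((norm y)\<^sup>2 + (norm c)\<^sup>2) \<le>
      2 * (y \<bullet> G i) + 2 * (z \<bullet> H i) + y \<bullet> (Q' *v y) + 2 * (c \<bullet> x) - c \<bullet> (Q i *v c)"
  defines "g \<equiv> \<Sum>i\<in>I. a i *\<^sub>R G i"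
  shows "g \<bullet> (matrix_inv Q' *v g)
    \<le> (\<Sum>i\<in>I. a i * (x \<bullet> (matrix_inv (Q i) *v x))) - \<mu> / (1 + \<delta>\<^sup>2) * (norm p)\<^sup>2"
proof -
  define y where "y = - (matrix_inv Q' *v g)"
  \<comment> \<open>The sum \<open>\<delta> *\<^sub>R y + c\<close> has to be the prescribed
    \<open>p\<close>, so the choice of \<open>y\<close> determines \<open>c\<close>.\<close>
  define c where "c = p - \<delta> *\<^sub>R y"
  have Qy: "Q' *v y = - g"
    by (simp add: y_def linear_neg mult_matrix_inv_vector[OF pos_def_invertible[OF Q']])
  \<comment> \<open>Cauchy-Schwarz passes from \<open>y\<close> and \<open>c\<close> to
    \<open>p\<close>; its defect is the square of
    \<open>\<bar>\<delta>\<bar> * norm c - norm y\<close>.\<close>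
  have "(norm p)\<^sup>2 \<le> (\<bar>\<delta>\<bar> * norm y + norm c)\<^sup>2"
    using norm_triangle_ineq[of "\<delta> *\<^sub>R y" c] by (intro power_mono) (simp_all add: c_def)
  also have "\<dots> \<le> (1 + \<delta>\<^sup>2) * ((norm y)\<^sup>2 + (norm c)\<^sup>2)"
    using zero_le_power2[of "\<bar>\<delta>\<bar> * norm c - norm y"]
    by (simp add: power2_sum power2_diff power_mult_distrib algebra_simps)
  finally have "\<mu> * (norm p)\<^sup>2 \<le> \<mu> * ((1 + \<delta>\<^sup>2) * ((norm y)\<^sup>2 + (norm c)\<^sup>2))"
    using \<open>0 \<le> \<mu>\<close> by (rule mult_left_mono)
  moreover have "0 < 1 + \<delta>\<^sup>2" by (simp add: add_pos_nonneg)
  ultimately have "\<mu> / (1 + \<delta>\<^sup>2) * (norm p)\<^sup>2 \<le> \<mu> * ((norm y)\<^sup>2 + (norm c)\<^sup>2)"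
    by (simp add: divide_le_eq mult_ac)
  also have "\<dots> \<le> (\<Sum>i\<in>I. a i * (2 * (y \<bullet> G i) + 2 * (z \<bullet> H i) + y \<bullet> (Q' *v y)
      + x \<bullet> (matrix_inv (Q i) *v x)))"
  proof (rule convex_sum_ge[OF a])
    fix i assume i: "i \<in> I"
    show "\<mu> * ((norm y)\<^sup>2 + (norm c)\<^sup>2) \<le> 2 * (y \<bullet> G i) + 2 * (z \<bullet> H i) + y \<bullet> (Q' *v y)
      + x \<bullet> (matrix_inv (Q i) *v x)"
      using diss[OF i, of y c] pos_def_conjugate_le[OF Q[OF i], of c x] by (simp add: c_def)
  qed auto
  also have "\<dots> = 2 * (y \<bullet> g) + 2 * (z \<bullet> (\<Sum>i\<in>I. a i *\<^sub>R H i)) + y \<bullet> (Q' *v y)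
      + (\<Sum>i\<in>I. a i * (x \<bullet> (matrix_inv (Q i) *v x)))"
  proof -
    have "(\<Sum>i\<in>I. a i * (y \<bullet> (Q' *v y))) = y \<bullet> (Q' *v y)"
      using a(2) by (simp flip: sum_distrib_right)
    then show ?thesis
      by (simp add: g_def inner_sum_right distrib_left sum.distrib sum_distrib_left mult_ac)
  qed
  \<comment> \<open>Since \<open>Q' *v y = - g\<close>, the terms
    \<open>2 * (y \<bullet> g) + y \<bullet> (Q' *v y)\<close> collapse to
    \<open>y \<bullet> g\<close>.\<close>
  also have "\<dots> = - (g \<bullet> (matrix_inv Q' *v g))
      + (\<Sum>i\<in>I. a i * (x \<bullet> (matrix_inv (Q i) *v x)))"
    unfolding Qy H by (simp add: y_def inner_commute)
  finally show ?thesis by simp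
qed

theorem theorem6:
  fixes f :: "real ^ ('n::finite) \<Rightarrow> real ^ 'n"
    and B :: "real ^ 'm ^ 'n"
    and Ahat :: "real ^ ('n + 'r::finite) ^ 'n"
    and Z :: "real ^ 'n \<Rightarrow> real ^ ('n + 'r)"
    and Zu :: "real ^ 'n \<Rightarrow> real ^ 'r"
    and eps :: "real ^ 'n \<Rightarrow> real ^ 'n"
    and epsbar :: real
    and SS :: "(real ^ 'n) set"
    and T :: nat
    and \<tau> :: "'t::finite \<Rightarrow> nat"
    and ud :: "nat \<Rightarrow> real ^ 'm"
    and xd yd wd :: "nat \<Rightarrow> real ^ 'n"
    and wbar :: real
    and U0 :: "real ^ 't ^ 'm"
    and Z0 Zt0 :: "real ^ 't ^ ('n + 'r)"
    and Y1 E0 W1 D0 :: "real ^ 't ^ 'n"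
    and \<Delta> :: "real ^ 'n ^ 'n"
    and XX :: "(real ^ 'n) set"
    and L :: "real ^ 'n \<Rightarrow> real ^ ('n::finite + 'r::finite) ^ 'r"
    and L1 :: "real ^ 'n \<Rightarrow> real ^ 'n ^ 'r"
    and L2 :: "real ^ 'n \<Rightarrow> real ^ 'r ^ 'r"
    and N :: nat
    and \<alpha> :: "nat \<Rightarrow> real ^ 'n \<Rightarrow> real"
    and v :: "nat \<Rightarrow> real ^ 'n"
    and LL :: "nat \<Rightarrow> real ^ ('n::finite + 'r::finite) ^ 'r"
    and \<delta> :: real
    and lam :: "nat \<Rightarrow> real"
    and R :: "nat \<Rightarrow> real ^ ('n::finite + 'r::finite) ^ 't"
    and Q :: "nat \<Rightarrow> real ^ 'n ^ 'n"
    and M :: "real ^ 'n ^ 'n"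
    and C1 :: "real ^ 'n ^ 'r"
    and C2 :: "real ^ 'r ^ 'r"
    and Ki :: "nat \<Rightarrow> real ^ ('n::finite + 'r::finite) ^ 'm"
    and K :: "real ^ 'n \<Rightarrow> real ^ ('n::finite + 'r::finite) ^ 'm"
    and P :: "real ^ 'n \<Rightarrow> real ^ 'n ^ 'n"
  assumes f_cont: "continuous_on UNIV f"
    and Z_cont: "continuous_on UNIV Z"
    and Z_zero: "Z 0 = 0"
    and Z_form: "\<And>x. Z x = vec_append x (Zu x)"
    and f_decomp: "\<And>x. f x = Ahat *v Z x + eps x"
    and epsbar_pos: "epsbar > 0"
    and SS_int: "0 \<in> interior SS"
    and eps_bound: "\<And>x. x \<in> SS \<Longrightarrow> norm (eps x) \<le> epsbar"
    and enum: "bij_betw \<tau> UNIV {0..<T}"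
    and traj: "\<And>k. k < T \<Longrightarrow> xd (Suc k) = f (xd k) + B *v ud k"
    and meas: "\<And>k. k \<le> T \<Longrightarrow> yd k = xd k + wd k"
    and noise: "\<And>k. k \<le> T \<Longrightarrow> norm (wd k) \<le> wbar"
    and U0: "U0 = columns \<tau> ud"
    and Z0: "Z0 = columns \<tau> (\<lambda>k. Z (yd k))"
    and Y1: "Y1 = columns \<tau> (\<lambda>k. yd (Suc k))"
    and Zt0: "Zt0 = columns \<tau> (\<lambda>k. Z (xd k))"
    and E0: "E0 = columns \<tau> (\<lambda>k. eps (xd k))"
    and W1: "W1 = columns \<tau> (\<lambda>k. wd (Suc k))"
    and D0: "D0 = W1 + E0 + Ahat ** (Zt0 - Z0)"
    and \<Delta>_psd: "pos_semidef \<Delta>"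
    and \<Delta>_bound: "pos_semidef (\<Delta> - D0 ** transpose D0)"
    and XX_int: "0 \<in> interior XX"
    and L_annih: "\<And>x. x \<in> XX \<Longrightarrow> L x *v Z x = 0"
    and L_split: "\<And>x. x \<in> XX \<Longrightarrow> L x = hcat (L1 x) (L2 x)"
    and L2_inv: "\<And>x. x \<in> XX \<Longrightarrow> invertible (L2 x)"
    and L_conv: "\<And>x. x \<in> XX \<Longrightarrow> L x = (\<Sum>i\<in>{1..N}. \<alpha> i x *\<^sub>R LL i)"
    and v_in: "\<And>i. i \<in> {1..N} \<Longrightarrow> v i \<in> XX"
    and LL: "\<And>i. i \<in> {1..N} \<Longrightarrow> LL i = L (v i)"
    and \<alpha>_cont: "\<And>i. i \<in> {1..N} \<Longrightarrow> continuous_on UNIV (\<alpha> i)"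
    and \<alpha>_nonneg: "\<And>i x. i \<in> {1..N} \<Longrightarrow> x \<in> XX \<Longrightarrow> \<alpha> i x \<ge> 0"
    and \<alpha>_sum: "\<And>x. x \<in> XX \<Longrightarrow> (\<Sum>i\<in>{1..N}. \<alpha> i x) = 1"
    and eps_small: "((\<lambda>x. norm (eps x) / norm x) \<longlongrightarrow> 0) (at 0)"
    and lam_pos: "\<And>i. i \<in> {1..N} \<Longrightarrow> lam i > 0"
    and Q_pd: "\<And>i. i \<in> {1..N} \<Longrightarrow> pos_def (Q i)"
    and C2_inv: "invertible C2"
    and lmi: "\<And>i j. i \<in> {1..N} \<Longrightarrow> j \<in> {1..N} \<Longrightarrow>
      pos_def (star_block3
        (symm (vcat Y1 (LL i ** Z0) ** R i ** block_mat (\<delta> *\<^sub>R mat 1) 0 0 (mat 1))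
           + block_mat (Q j - lam i *\<^sub>R \<Delta>) 0 0 0)
        (transpose (vcat Y1 (LL i ** Z0) ** R i ** vcat (mat 1) 0 + vcat (\<delta> *\<^sub>R transpose M) 0))
        (symm M - Q i)
        (R i ** block_mat (\<delta> *\<^sub>R mat 1) 0 0 (mat 1))
        (R i ** vcat (mat 1) 0)
        (lam i *\<^sub>R mat 1))"
    and ZR: "\<And>i. i \<in> {1..N} \<Longrightarrow> Z0 ** R i = block_mat M 0 C1 C2"
    and Ki: "\<And>i. i \<in> {1..N} \<Longrightarrow> Ki i = U0 ** R i ** matrix_inv (block_mat M 0 C1 C2)"
    and K: "\<And>x. K x = (\<Sum>i\<in>{1..N}. \<alpha> i x *\<^sub>R Ki i)"
    and P: "\<And>x. P x = (\<Sum>i\<in>{1..N}. \<alpha> i x *\<^sub>R matrix_inv (Q i))"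
  shows "locally_asymptotically_stable (\<lambda>x. (Ahat + B ** K x) *v Z x + eps x) \<and>
    lyapunov_function (\<lambda>x. (Ahat + B ** K x) *v Z x + eps x) (\<lambda>x. x \<bullet> (P x *v x))"
proof -
  define I where "I = {1..N}"
  have fin: "finite I" by (simp add: I_def)
  define F where "F = (\<lambda>x. (Ahat + B ** K x) *v Z x + eps x)"
  define V where "V = (\<lambda>x. x \<bullet> (P x *v x))"
  define Qi where "Qi i = matrix_inv (Q i)" for i
  define G where "G = block_mat M 0 C1 C2"

  have XX0: "0 \<in> XX" using XX_int interior_subset by blast
  \<comment> \<open>The weights sum to one at the origin, so some vertex exists; \<open>i0\<close>
    serves for the invertibility of \<open>M\<close> and for \<open>0 < C\<close>.\<close>
  have "I \<noteq> {}" using \<alpha>_sum[OF XX0] unfolding I_def by (metis sum.empty zero_neq_one)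
  then obtain i0 where i0: "i0 \<in> I" by blast

  \<comment> \<open>Data equation and vertex inequalities\<close>
  have \<tau>: "\<tau> j < T" for j using bij_betwE[OF enum] by auto
  \<comment> \<open>The last term of \<open>D0\<close> trades the measured regressors for the true
    ones; the columns then are the equations of motion plus measurement noise.\<close>
  have "Ahat ** Z0 + Ahat ** (Zt0 - Z0) = Ahat ** Zt0"
    by (simp flip: matrix_add_ldistrib)
  then have "Ahat ** Z0 + B ** U0 + D0 = W1 + E0 + Ahat ** Zt0 + B ** U0"
    unfolding D0 by (simp add: algebra_simps)
  also have "\<dots> = Y1"
    unfolding W1 E0 Zt0 U0 Y1 matrix_mult_columns columns_add
    using \<tau> by (intro columns_cong) (simp add: meas traj f_decomp Suc_leI)
  finally have data: "Y1 - D0 = Ahat ** Z0 + B ** U0" by (simp add: algebra_simps)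

  \<comment> \<open>Two indices keep apart the weights at the present state (\<open>i\<close>) and
    at its successor (\<open>j\<close>).\<close>
  define E where "E i j y z c =
    2 * (y \<bullet> ((Y1 - D0) *v (R i *v vec_append (\<delta> *\<^sub>R y + c) z)))
    + 2 * (z \<bullet> ((LL i ** Z0) *v (R i *v vec_append (\<delta> *\<^sub>R y + c) z)))
    + y \<bullet> (Q j *v y) + 2 * (c \<bullet> (M *v (\<delta> *\<^sub>R y + c))) - c \<bullet> (Q i *v c)" for i j y z c
  obtain \<mu> where "0 < \<mu>" and "\<And>ij. ij \<in> I \<times> I \<Longrightarrow>
    \<forall>y z c. \<mu> * ((norm y)\<^sup>2 + (norm c)\<^sup>2) \<le> E (fst ij) (snd ij) y z c"
  proof (rule pos_bound_uniform)
    show "finite (I \<times> I)" using fin by simp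
    show "\<exists>\<mu>>0. \<forall>y z c. \<mu> * ((norm y)\<^sup>2 + (norm c)\<^sup>2) \<le> E (fst ij) (snd ij) y z c"
      if "ij \<in> I \<times> I" for ij
      unfolding E_def using dissipation_inequality_if_lmi[OF lam_pos \<Delta>_bound lmi] that
      by (auto simp: I_def simp del: One_nat_def)
  next
    fix ij and \<mu> \<nu> :: real
    assume *: "\<forall>y z c. \<mu> * ((norm y)\<^sup>2 + (norm c)\<^sup>2) \<le> E (fst ij) (snd ij) y z c" and "\<nu> \<le> \<mu>"
    then have "\<nu> * ((norm y)\<^sup>2 + (norm c)\<^sup>2) \<le> \<mu> * ((norm y)\<^sup>2 + (norm c)\<^sup>2)"
      for y c :: "real ^ 'n"
      by (intro mult_right_mono) auto
    with * show "\<forall>y z c. \<nu> * ((norm y)\<^sup>2 + (norm c)\<^sup>2) \<le> E (fst ij) (snd ij) y z c"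
      by (meson order_trans)
  qed auto
  then have \<mu>: "\<mu> * ((norm y)\<^sup>2 + (norm c)\<^sup>2) \<le> E i j y z c" if "i \<in> I" "j \<in> I" for i j y z c
    using that by fastforce

  \<comment> \<open>Invertibility and the closed loop in terms of data\<close>
  have M_inv: "invertible M"
  proof (rule invertible_if_ker_trivial)
    fix c assume "M *v c = 0"
    \<comment> \<open>All terms containing \<open>y\<close> or \<open>z\<close> vanish, and so does
      \<open>c \<bullet> (M *v c)\<close>, which leaves a nonpositive right-hand side.\<close>
    with \<mu>[OF i0 i0, where y = 0 and z = 0 and c = c] have "\<mu> * (norm c)\<^sup>2 \<le> - (c \<bullet> (Q i0 *v c))"
      by (simp add: E_def)
    also have "\<dots> \<le> 0" using pos_def_inner_nonneg[OF Q_pd[OF i0[unfolded I_def]], of c] by simp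
    finally show "c = 0" using \<open>0 < \<mu>\<close> by (simp add: mult_le_0_iff)
  qed
  have G_inv: "invertible G"
    unfolding G_def by (rule invertible_block_triangular[OF M_inv C2_inv])

  \<comment> \<open>The vector \<open>R i *v w\<close> yields the regressor \<open>G *v w\<close>
    through \<open>Z0\<close> and the matching input through \<open>U0\<close>, so the data equation
    eliminates the unknown \<open>Ahat\<close> and \<open>B\<close>.\<close>
  have closed_loop: "(Ahat + B ** Ki i) *v (G *v w) = (Y1 - D0) *v (R i *v w)" if "i \<in> I" for i w
  proof -
    have "Ki i *v (G *v w) = U0 *v (R i *v w)"
      using Ki[of i] that matrix_inv_mult(2)[OF G_inv]
      by (simp add: I_def G_def[symmetric] matrix_vector_mul_assoc matrix_mul_assoc[symmetric])
    moreover have "G *v w = Z0 *v (R i *v w)"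
      using ZR[of i] that by (simp add: I_def G_def matrix_vector_mul_assoc)
    ultimately show ?thesis unfolding data
      by (simp add: matrix_vector_mult_add_rdistrib matrix_vector_mul_assoc[symmetric])
  qed

  \<comment> \<open>Decrease along the nominal closed loop\<close>
  obtain k where k: "0 < k" "\<And>p. norm (M *v p) \<le> norm p * k"
    using bounded_linear.pos_bounded[OF matrix_vector_mul_bounded_linear] by blast
  \<comment> \<open>Below, \<open>M *v p = x\<close> and hence
    \<open>norm x \<le> norm p * k\<close>; dividing by \<open>k\<^sup>2\<close> turns a decrease in
    terms of \<open>norm p\<close> into one in terms of \<open>norm x\<close>.\<close>
  define \<kappa> where "\<kappa> = \<mu> / (1 + \<delta>\<^sup>2) / k\<^sup>2"
  have "0 < \<kappa>" using \<open>0 < \<mu>\<close> k(1) by (simp add: \<kappa>_def add_pos_nonneg)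

  have V_eq: "V x = (\<Sum>i\<in>I. \<alpha> i x * (x \<bullet> (Qi i *v x)))" for x
    by (simp add: V_def P I_def Qi_def matrix_vector_mult_sum_left inner_sum_right
        scaleR_matrix_vector_assoc[symmetric])

  have nominal: "((Ahat + B ** K x) *v Z x) \<bullet> (Qi j *v ((Ahat + B ** K x) *v Z x))
      \<le> V x - \<kappa> * (norm x)\<^sup>2" if x: "x \<in> XX" and j: "j \<in> I" for x j
  proof -
    define w where "w = matrix_inv G *v Z x"
    have Gw: "G *v w = Z x" by (simp add: w_def mult_matrix_inv_vector[OF G_inv])
    obtain p z where w: "w = vec_append p z" by (rule vec_append_cases)
    have Mp: "M *v p = x" using Gw by (simp add: G_def w Z_form)
    \<comment> \<open>As the weights sum to one, \<open>Ahat *v Z x\<close> can be moved under the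
      sum.\<close>
    have g: "(Ahat + B ** K x) *v Z x = (\<Sum>i\<in>I. \<alpha> i x *\<^sub>R ((Y1 - D0) *v (R i *v w)))"
    proof -
      have "(\<Sum>i\<in>I. \<alpha> i x *\<^sub>R ((Y1 - D0) *v (R i *v w)))
          = (\<Sum>i\<in>I. \<alpha> i x *\<^sub>R (Ahat *v Z x) + B *v (\<alpha> i x *\<^sub>R (Ki i *v Z x)))"
        by (intro sum.cong refl) (simp add: closed_loop[symmetric] Gw matrix_vector_mult_add_rdistrib
            matrix_vector_mul_assoc[symmetric] scaleR_add_right matrix_vector_mult_scaleR)
      also have "\<dots> = Ahat *v Z x + B *v (K x *v Z x)"
        using \<alpha>_sum[OF x]
        by (simp add: sum.distrib K I_def matrix_vector_mult_sum_left
            linear_sum[OF matrix_vector_mul_linear]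
            scaleR_matrix_vector_assoc[symmetric] flip: scaleR_sum_left)
      finally show ?thesis
        by (simp add: matrix_vector_mult_add_rdistrib matrix_vector_mul_assoc[symmetric])
    qed
    \<comment> \<open>For each vertex \<open>Z0 *v (R i *v w)\<close> equals \<open>Z x\<close>, so
      the sum is \<open>L x *v Z x\<close>.\<close>
    have h: "(\<Sum>i\<in>I. \<alpha> i x *\<^sub>R ((LL i ** Z0) *v (R i *v w))) = 0"
    proof -
      have "(\<Sum>i\<in>I. \<alpha> i x *\<^sub>R ((LL i ** Z0) *v (R i *v w))) = (\<Sum>i\<in>I. \<alpha> i x *\<^sub>R (LL i *v Z x))"
        using ZR by (intro sum.cong refl)
          (simp add: I_def G_def Gw[symmetric] matrix_vector_mul_assoc[symmetric]
            arg_cong[where f = "\<lambda>X. X *v w", OF ZR, unfolded matrix_vector_mul_assoc[symmetric]])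
      also have "\<dots> = L x *v Z x"
        by (simp add: L_conv[OF x] I_def matrix_vector_mult_sum_left scaleR_matrix_vector_assoc[symmetric])
      finally show ?thesis using L_annih[OF x] by simp
    qed
    have "((Ahat + B ** K x) *v Z x) \<bullet> (Qi j *v ((Ahat + B ** K x) *v Z x))
        \<le> V x - \<mu> / (1 + \<delta>\<^sup>2) * (norm p)\<^sup>2"
      unfolding V_eq Qi_def g
    proof (rule averaged_dissipation_decrease[OF _ _ _ _ _ h, where z = z])
      fix i y c assume i: "i \<in> I" and p: "\<delta> *\<^sub>R y + c = p"
      show "\<mu> * ((norm y)\<^sup>2 + (norm c)\<^sup>2) \<le> 2 * (y \<bullet> ((Y1 - D0) *v (R i *v w)))
          + 2 * (z \<bullet> ((LL i ** Z0) *v (R i *v w))) + y \<bullet> (Q j *v y) + 2 * (c \<bullet> x) - c \<bullet> (Q i *v c)"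
        using \<mu>[OF i j, of y c z] unfolding E_def p w Mp .
    qed (use \<open>0 < \<mu>\<close> \<alpha>_nonneg \<alpha>_sum Q_pd x j in \<open>auto simp: I_def simp del: One_nat_def\<close>)
    also have "\<dots> \<le> V x - \<kappa> * (norm x)\<^sup>2"
    proof -
      have "(norm x)\<^sup>2 \<le> (norm p * k)\<^sup>2" using k(2)[of p] Mp by (intro power_mono) auto
      then have "\<kappa> * (norm x)\<^sup>2 \<le> \<kappa> * (norm p * k)\<^sup>2" using \<open>0 < \<kappa>\<close> by simp
      also have "\<dots> = \<mu> / (1 + \<delta>\<^sup>2) * (norm p)\<^sup>2"
        using k(1) by (simp add: \<kappa>_def power_mult_distrib)
      finally show ?thesis by simp
    qed
    finally show ?thesis .
  qed

  \<comment> \<open>Quadratic bounds on \<open>V\<close> and the robustness margin\<close>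
  have Qi_pd: "pos_def (Qi i)" if "i \<in> I" for i
    using that Q_pd by (simp add: Qi_def I_def pos_def_matrix_inv)
  obtain m where "0 < m" and m: "\<And>i. i \<in> I \<Longrightarrow> \<forall>x. m * (norm x)\<^sup>2 \<le> x \<bullet> (Qi i *v x)"
  proof (rule pos_bound_uniform[OF fin])
    show "\<exists>m>0. \<forall>x. m * (norm x)\<^sup>2 \<le> x \<bullet> (Qi i *v x)" if "i \<in> I" for i
      using pos_def_lower_bound[of "Qi i"] pos_def_inner_pos[OF Qi_pd[OF that]] by metis
    show "\<forall>x. \<nu> * (norm x)\<^sup>2 \<le> x \<bullet> (Qi i *v x)"
      if "\<forall>x. \<mu> * (norm x)\<^sup>2 \<le> x \<bullet> (Qi i *v x)" "\<nu> \<le> \<mu>" for i \<mu> \<nu>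
      using that by (meson mult_right_mono order_trans zero_le_power2)
  qed auto
  obtain c where c: "\<And>i. 0 < c i" "\<And>i x y. \<bar>x \<bullet> (Qi i *v y)\<bar> \<le> c i * norm x * norm y"
  proof -
    have "\<forall>i. \<exists>k>0. \<forall>x y. \<bar>x \<bullet> (Qi i *v y)\<bar> \<le> k * norm x * norm y"
      using bilinear_bound by blast
    then show thesis using that by metis
  qed
  define C where "C = sum c I"
  have "0 < C" unfolding C_def using c(1) i0 fin by (intro sum_pos) auto
  have V_lower: "m * (norm x)\<^sup>2 \<le> V x" if "x \<in> XX" for x
    unfolding V_eq using that \<alpha>_nonneg \<alpha>_sum m
    by (intro convex_sum_ge) (auto simp: I_def simp del: One_nat_def)
  have V_upper: "V x \<le> C * (norm x)\<^sup>2" if "x \<in> XX" for x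
    unfolding V_eq
  proof (rule convex_sum_le)
    fix i assume i: "i \<in> I"
    have "x \<bullet> (Qi i *v x) \<le> c i * (norm x)\<^sup>2"
      using c(2)[of x i x] by (simp add: power2_eq_square mult_ac)
    also have "\<dots> \<le> C * (norm x)\<^sup>2"
      unfolding C_def using i fin c(1) by (intro mult_right_mono member_le_sum) (auto simp: less_imp_le)
    finally show "x \<bullet> (Qi i *v x) \<le> C * (norm x)\<^sup>2" .
  qed (use that \<alpha>_nonneg \<alpha>_sum in \<open>auto simp: I_def simp del: One_nat_def\<close>)

  \<comment> \<open>The margin is uniform in \<open>j\<close>, since the value of \<open>V\<close>
    at the successor mixes all the forms \<open>Qi j\<close>.\<close>
  obtain \<eta> where "0 < \<eta>" and \<eta>: "\<And>j. j \<in> I \<Longrightarrow>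
    \<forall>s g e b. g \<bullet> (Qi j *v g) \<le> b - \<kappa> * s\<^sup>2 \<longrightarrow> b \<le> C * s\<^sup>2 \<longrightarrow> 0 \<le> s \<longrightarrow>
      norm e \<le> \<eta> * s \<longrightarrow> (g + e) \<bullet> (Qi j *v (g + e)) \<le> b - \<kappa> / 2 * s\<^sup>2"
  proof (rule pos_bound_uniform[OF fin])
    show "\<exists>\<eta>>0. \<forall>s g e b. g \<bullet> (Qi j *v g) \<le> b - \<kappa> * s\<^sup>2 \<longrightarrow> b \<le> C * s\<^sup>2 \<longrightarrow> 0 \<le> s \<longrightarrow>
      norm e \<le> \<eta> * s \<longrightarrow> (g + e) \<bullet> (Qi j *v (g + e)) \<le> b - \<kappa> / 2 * s\<^sup>2" if "j \<in> I" for j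
      by (rule decrease_robust_small_perturbation[OF Qi_pd[OF that] \<open>0 < C\<close> \<open>0 < \<kappa>\<close>])
  next
    fix j \<eta> \<nu>
    assume *: "\<forall>s g e b. g \<bullet> (Qi j *v g) \<le> b - \<kappa> * s\<^sup>2 \<longrightarrow> b \<le> C * s\<^sup>2 \<longrightarrow> 0 \<le> s \<longrightarrow>
      norm e \<le> \<eta> * s \<longrightarrow> (g + e) \<bullet> (Qi j *v (g + e)) \<le> b - \<kappa> / 2 * s\<^sup>2" and "\<nu> \<le> \<eta>"
    then have "norm e \<le> \<eta> * s" if "norm e \<le> \<nu> * s" "0 \<le> s" for e :: "real ^ 'n" and s
      using that by (meson mult_right_mono order_trans)
    with * show "\<forall>s g e b. g \<bullet> (Qi j *v g) \<le> b - \<kappa> * s\<^sup>2 \<longrightarrow> b \<le> C * s\<^sup>2 \<longrightarrow> 0 \<le> s \<longrightarrow>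
      norm e \<le> \<nu> * s \<longrightarrow> (g + e) \<bullet> (Qi j *v (g + e)) \<le> b - \<kappa> / 2 * s\<^sup>2"
      by blast
  qed auto

  \<comment> \<open>The approximation error near the origin\<close>
  have eps_eq: "eps = (\<lambda>x. f x - Ahat *v Z x)" by (auto simp: f_decomp)
  have eps_cont: "continuous_on UNIV eps"
    unfolding eps_eq
    by (intro continuous_intros f_cont linear_continuous_on_compose[OF Z_cont] matrix_vector_mul_linear)
  obtain r1 where "0 < r1" and r1: "\<And>x. norm x < r1 \<Longrightarrow> x \<noteq> 0 \<Longrightarrow> norm (eps x) \<le> \<eta> * norm x"
  proof -
    have "eventually (\<lambda>x. norm (eps x) / norm x < \<eta>) (at 0)"
      using eps_small \<open>0 < \<eta>\<close> by (rule order_tendstoD)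
    then obtain d where "0 < d" "\<And>x. x \<noteq> 0 \<Longrightarrow> norm x < d \<Longrightarrow> norm (eps x) / norm x < \<eta>"
      by (auto simp: eventually_at dist_norm)
    then show thesis by (intro that[of d]) (auto simp: divide_less_eq less_imp_le)
  qed
  \<comment> \<open>The limit hypothesis says nothing at the origin itself. Multiplying the quotient
    by \<open>norm x\<close> shows that \<open>eps\<close> tends to zero there, and continuity gives
    the value.\<close>
  have eps0: "eps 0 = 0"
  proof -
    have "((\<lambda>x. norm (eps x) / norm x * norm x) \<longlongrightarrow> 0) (at 0)"
      by (intro tendsto_mult_zero eps_small tendsto_norm_zero tendsto_ident_at)
    then have "((\<lambda>x. norm (eps x)) \<longlongrightarrow> 0) (at 0)"
      by (rule Lim_transform_eventually) (auto simp: eventually_at_filter)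
    moreover have "((\<lambda>x. norm (eps x)) \<longlongrightarrow> norm (eps 0)) (at 0)"
      using eps_cont by (intro tendsto_norm) (simp add: continuous_on_def)
    ultimately show ?thesis using tendsto_unique[OF trivial_limit_at] by fastforce
  qed
  have F0: "F 0 = 0" by (simp add: F_def Z_zero eps0)

  \<comment> \<open>Continuity of the closed loop and of \<open>V\<close>\<close>
  have "continuous_on UNIV F"
  proof -
    have "F = (\<lambda>x. Ahat *v Z x + B *v (\<Sum>i\<in>I. \<alpha> i x *\<^sub>R (Ki i *v Z x)) + eps x)"
      by (auto simp: F_def K I_def matrix_vector_mult_add_rdistrib matrix_vector_mul_assoc[symmetric]
          matrix_vector_mult_sum_left scaleR_matrix_vector_assoc[symmetric])
    then show ?thesis
      using \<alpha>_cont by (auto simp: I_def intro!: continuous_intros eps_cont Z_cont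
          linear_continuous_on_compose[OF _ matrix_vector_mul_linear] simp del: One_nat_def)
  qed
  have V_cont: "continuous_on UNIV V"
    unfolding V_eq using \<alpha>_cont
    by (auto simp: I_def intro!: continuous_intros
          linear_continuous_on_compose[OF _ matrix_vector_mul_linear] simp del: One_nat_def)

  \<comment> \<open>The neighbourhood of decrease and the conclusion\<close>
  obtain r2 where "0 < r2" and r2: "\<And>x. norm x < r2 \<Longrightarrow> x \<in> XX"
    using XX_int by (auto simp: mem_interior subset_eq)
  \<comment> \<open>\<open>V (F x)\<close> is averaged with the weights at \<open>F x\<close>, which
    are known to be convex only on \<open>XX\<close>; so the successor must lie in \<open>XX\<close>
    as well.\<close>
  obtain r3 where "0 < r3" and r3: "\<And>x. norm x < r3 \<Longrightarrow> norm (F x) < r2"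
  proof -
    have "isCont F 0" using \<open>continuous_on UNIV F\<close> by (simp add: continuous_on_eq_continuous_at)
    then show thesis
      using that \<open>0 < r2\<close> F0 unfolding continuous_at_eps_delta
      by (metis dist_norm dist_0_norm dist_commute diff_zero)
  qed
  define r where "r = Min {r1, r2, r3}"
  have "0 < r" using \<open>0 < r1\<close> \<open>0 < r2\<close> \<open>0 < r3\<close> by (simp add: r_def)

  have in_XX: "x \<in> XX" "F x \<in> XX" if "norm x < r" for x
    using that r2 r3 by (auto simp: r_def)
  \<comment> \<open>The bound holds for each form \<open>Qi j\<close> separately, hence for their
    average with the weights at \<open>F x\<close>, whatever these are. This is why the matrix
    inequality is imposed for all pairs of vertices.\<close>
  have decr: "V (F x) \<le> V x - \<kappa> / 2 * (norm x)\<^sup>2" if x: "norm x < r" for x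
    unfolding V_eq[of "F x"]
  proof (rule convex_sum_le)
    fix j assume j: "j \<in> I"
    have "norm (eps x) \<le> \<eta> * norm x" using x r1[of x] eps0 by (cases "x = 0") (auto simp: r_def)
    then show "F x \<bullet> (Qi j *v F x) \<le> V x - \<kappa> / 2 * (norm x)\<^sup>2"
      unfolding F_def using \<eta>[OF j] nominal[OF in_XX(1)[OF x] j] V_upper[OF in_XX(1)[OF x]]
      by simp
  qed (use \<alpha>_nonneg \<alpha>_sum in_XX(2)[OF x] in \<open>auto simp: I_def simp del: One_nat_def\<close>)

  have "locally_asymptotically_stable F"
  proof (rule locally_asymptotically_stable_if_quadratic_decrease
      [where r = r and m = m and \<kappa> = "\<kappa> / 2" and V = V])
    show "isCont V 0" using V_cont by (simp add: continuous_on_eq_continuous_at)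
    show "V 0 = 0" by (simp add: V_def)
  qed (use V_lower in_XX decr F0 \<open>0 < r\<close> \<open>0 < m\<close> \<open>0 < \<kappa>\<close> in auto)
  moreover have "lyapunov_function F V"
    unfolding lyapunov_function_def
  proof (intro exI[of _ "ball 0 r"] conjI ballI)
    show "continuous_on (ball 0 r) V" using V_cont by (rule continuous_on_subset) simp
    fix x :: "real ^ 'n" assume "x \<in> ball 0 r - {0}"
    then have x: "norm x < r" "0 < (norm x)\<^sup>2" by auto
    show "0 < V x" using V_lower[OF in_XX(1)[OF x(1)]] mult_pos_pos[OF \<open>0 < m\<close> x(2)] by linarith
    show "V (F x) - V x < 0"
      using decr[OF x(1)] mult_pos_pos[OF half_gt_zero[OF \<open>0 < \<kappa>\<close>] x(2)] by linarith
  qed (use \<open>0 < r\<close> in \<open>auto simp: V_def\<close>)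
  ultimately show ?thesis by (simp only: F_def V_def)
qed

end
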